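(* Let $V$ be a Banach space. Assume that $A\in AA(\mathbb{R},\mathbb{C}^{p\times p})$ and that $y'=A(t)y$ has an exponential dichotomy (with constants $c,\alpha>0$ and Green matrix $G$) with a projection $P$ that commutes with the fundamental matrix $\Phi_A(t)$. Assume that $f\in AA(\mathbb{R},V^p)$. Then the linear non-homogeneous equation $y'=A(t)y+f(t)$ has a unique solution in $AA(\mathbb{R},V^p)$, given by $$y(t)=\int_{\mathbb{R}}G(t,s)f(s)\,ds,$$ and satisfying $$\|y\|_\infty\le\frac{2c}{\alpha}\|f\|_\infty.$$
   Context: For a Banach space $W$, $AA(\mathbb{R},W)$ is the set of almost automorphic functions: continuous $\psi:\mathbb{R}\to W$ such that every real sequence has a subsequence $\{\tau_n\}$ for which $\tilde\psi(t)=\lim_n\psi(t+\tau_n)$ and $\psi(t)=\lim_n\tilde\psi(t-\tau_n)$ (pointwise) for all $t\in\mathbb{R}$. $\Phi_A(t)$ is a fundamental matrix of $y'=A(t)y$. This system has an ($\alpha$-)exponential dichotomy if there exist a projection $P$ and positive constants $c,\alpha$ such that $\|G(t,s)\|\le c\exp(-\alpha|t-s|)$ for all $(t,s)\in\mathbb{R}^2$, where the Green matrix is $G(t,s)=\Phi_A(t)P\Phi_A^{-1}(s)$ for $t\ge s$ and $G(t,s)=-\Phi_A(t)(I-P)\Phi_A^{-1}(s)$ otherwise. $\|\cdot\|_\infty$ is the sup norm over $\mathbb{R}$. *)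

theory Defs
  imports "HOL-Analysis.Analysis"
begin

text \<open>
  Complex Banach spaces. HOL-Analysis only provides real ones (class \<^class>\<open>banach\<close>), but complex
  matrices have to act on $V^p$.
\<close>

class complex_banach = banach +
  fixes scaleC :: "complex \<Rightarrow> 'a \<Rightarrow> 'a"  (infixr "*\<^sub>C" 75)
  assumes scaleC_add_right: "a *\<^sub>C (x + y) = a *\<^sub>C x + a *\<^sub>C y"
    and scaleC_add_left: "(a + b) *\<^sub>C x = a *\<^sub>C x + b *\<^sub>C x"
    and scaleC_scaleC: "a *\<^sub>C b *\<^sub>C x = (a * b) *\<^sub>C x"
    and scaleC_of_real: "complex_of_real r *\<^sub>C x = r *\<^sub>R x"
    and norm_scaleC: "norm (a *\<^sub>C x) = cmod a * norm x"

instantiation complex :: complex_banach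
begin

definition scaleC_complex :: "complex \<Rightarrow> complex \<Rightarrow> complex" where
  "scaleC_complex a x = a * x"

instance
  by standard (simp_all add: scaleC_complex_def algebra_simps norm_mult scaleR_conv_of_real)

end

text \<open>The action of a complex matrix on $V^p$, rendered as \<^typ>\<open>'v ^ 'p\<close>.\<close>

definition matrix_act :: "complex ^ 'p ^ 'p \<Rightarrow> ('v::complex_banach) ^ 'p \<Rightarrow> 'v ^ 'p"
    (infixr "*\<^sub>V" 75) where
  "M *\<^sub>V v = (\<chi> i. \<Sum>j\<in>UNIV. (M $ i $ j) *\<^sub>C (v $ j))"

definition almost_automorphic :: "(real \<Rightarrow> 'w::banach) set" where
  "almost_automorphic =
    {\<psi>. continuous_on UNIV \<psi> \<and>
      (\<forall>\<sigma>::nat \<Rightarrow> real. \<exists>r::nat \<Rightarrow> nat. strict_mono r \<and>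
        (\<exists>\<psi>'. \<forall>t. (\<lambda>n. \<psi> (t + \<sigma> (r n))) \<longlonglongrightarrow> \<psi>' t \<and>
                  (\<lambda>n. \<psi>' (t - \<sigma> (r n))) \<longlonglongrightarrow> \<psi> t))}"

text \<open>
  Norms on $V^p$ and on the matrices are kept as explicit functions, since the quantitative statements
  depend on them: the library norms (Euclidean, Frobenius) are only one choice, others being
  for instance the maximum norm together with the maximal row sum. The library norms enter through
  the topology only, which is the product topology. Only real homogeneity is demanded, so every
  norm on a complex space is covered.
\<close>

definition is_norm :: "('w::real_vector \<Rightarrow> real) \<Rightarrow> bool" where
  "is_norm N \<longleftrightarrow>
    (\<forall>x. N x = 0 \<longleftrightarrow> x = 0) \<and>
    (\<forall>r x. N (r *\<^sub>R x) = \<bar>r\<bar> * N x) \<and>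
    (\<forall>x y. N (x + y) \<le> N x + N y)"

definition equivalent_norm :: "('w::real_normed_vector \<Rightarrow> real) \<Rightarrow> bool" where
  "equivalent_norm N \<longleftrightarrow>
    is_norm N \<and> (\<exists>a>0. \<exists>b>0. \<forall>x. a * norm x \<le> N x \<and> N x \<le> b * norm x)"

definition compatible_norms ::
    "(complex ^ 'p ^ 'p \<Rightarrow> real) \<Rightarrow> (('v::complex_banach) ^ 'p \<Rightarrow> real) \<Rightarrow> bool" where
  "compatible_norms normM normV \<longleftrightarrow> (\<forall>M v. normV (M *\<^sub>V v) \<le> normM M * normV v)"

text \<open>
  A supremum of reals, hence meaningful for bounded functions only; almost automorphic functions
  are bounded.
\<close>

definition sup_norm :: "('w \<Rightarrow> real) \<Rightarrow> (real \<Rightarrow> 'w) \<Rightarrow> real" where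
  "sup_norm N \<psi> = (SUP t. N (\<psi> t))"

definition fundamental_matrix ::
    "(real \<Rightarrow> complex ^ 'p ^ 'p) \<Rightarrow> (real \<Rightarrow> complex ^ 'p ^ 'p) \<Rightarrow> bool" where
  "fundamental_matrix A \<Phi> \<longleftrightarrow>
    (\<forall>t. (\<Phi> has_vector_derivative A t ** \<Phi> t) (at t)) \<and> (\<forall>t. invertible (\<Phi> t))"

definition green_matrix ::
    "(real \<Rightarrow> complex ^ 'p ^ 'p) \<Rightarrow> complex ^ 'p ^ 'p \<Rightarrow> real \<Rightarrow> real \<Rightarrow> complex ^ 'p ^ 'p" where
  "green_matrix \<Phi> P t s =
    (if t \<ge> s then \<Phi> t ** P ** matrix_inv (\<Phi> s)
     else - (\<Phi> t ** (mat 1 - P) ** matrix_inv (\<Phi> s)))"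

definition exponential_dichotomy ::
    "(complex ^ 'p ^ 'p \<Rightarrow> real) \<Rightarrow> (real \<Rightarrow> complex ^ 'p ^ 'p) \<Rightarrow> (real \<Rightarrow> complex ^ 'p ^ 'p) \<Rightarrow>
      complex ^ 'p ^ 'p \<Rightarrow> real \<Rightarrow> real \<Rightarrow> bool" where
  "exponential_dichotomy normM A \<Phi> P c \<alpha> \<longleftrightarrow>
    fundamental_matrix A \<Phi> \<and> P ** P = P \<and> c > 0 \<and> \<alpha> > 0 \<and>
    (\<forall>t s. normM (green_matrix \<Phi> P t s) \<le> c * exp (- \<alpha> * \<bar>t - s\<bar>))"

definition linear_ode_solution ::
    "(real \<Rightarrow> complex ^ 'p ^ 'p) \<Rightarrow> (real \<Rightarrow> ('v::complex_banach) ^ 'p) \<Rightarrow> (real \<Rightarrow> 'v ^ 'p) \<Rightarrow> bool"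
  where
  "linear_ode_solution A f y \<longleftrightarrow>
    (\<forall>t. (y has_vector_derivative A t *\<^sub>V y t + f t) (at t))"

end

theory Submission
  imports Defs "HOL-Real_Asymp.Real_Asymp"
begin

text \<open>
  Let $\psi' = \Phi^{-1} g$ with $g$ bounded and continuous. The dichotomy gives limits
  $p = \lim_{-\infty} P \psi$ and $q = \lim_{+\infty} (I - P) \psi$, and the fundamental theorem of
  calculus on both sides of $t$ gives $\int G(t,s) g(s)\,ds = \Phi(t) (\psi(t) - p - q)$. With
  $g = f$ the right-hand side is a solution. If $\psi = \Phi^{-1} w$ for a bounded solution $w$, then
  $p = q = 0$, so every bounded solution is given by the Green matrix.

  For almost automorphy no convergence of the Green matrix along translations is needed: the difference
  $w = y(\cdot + h) - y$ is a bounded solution of $w' = A w + g$ with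
  $g = (A(\cdot + h) - A)\, y(\cdot + h) + f(\cdot + h) - f$, so with $H = (A, f)$
  \[ |y(t + h) - y(t)| \le K \int e^{-\alpha |u|} |H(t + h - u) - H(t - u)| \,du, \]
  and dominated convergence for real integrands transfers almost automorphy from $H$ to $y$.
\<close>

section \<open>Complex matrices acting on $V^p$\<close>

lemma bounded_bilinear_matrix_mult:
  "bounded_bilinear ((**) :: complex ^ 'm ^ 'k \<Rightarrow> complex ^ 'n ^ 'm \<Rightarrow> complex ^ 'n ^ 'k)"
  unfolding bilinear_conv_bounded_bilinear [symmetric] bilinear_def
  by (auto intro!: linearI simp: vec_eq_iff matrix_matrix_mult_def algebra_simps
      sum.distrib scaleR_sum_right)

lemma norm_vec_le_sum: "norm x \<le> (\<Sum>i\<in>UNIV. norm (x $ i))"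
  for x :: "'a::real_normed_vector ^ 'n"
  unfolding norm_vec_def by (rule L2_set_le_sum) simp

text \<open>Each component is a sum of p terms, each at most \<open>norm M * norm v\<close>, and
  there are p components. The constant is crude because it only has to establish
  boundedness.\<close>

lemma norm_matrix_act_le:
  "norm (M *\<^sub>V v) \<le> norm M * norm v * (real CARD('p))\<^sup>2"
  for v :: "'v::complex_banach ^ 'p"
proof -
  have "norm ((M *\<^sub>V v) $ i) \<le> (\<Sum>j\<in>(UNIV::'p set). norm M * norm v)" for i
  proof -
    have "norm ((M $ i $ j) *\<^sub>C (v $ j)) \<le> norm M * norm v" for j
      unfolding norm_scaleC
      by (intro mult_mono norm_nth_le Finite_Cartesian_Product.norm_nth_le
          order_trans [OF Finite_Cartesian_Product.norm_nth_le Finite_Cartesian_Product.norm_nth_le]) auto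
    then show ?thesis
      unfolding matrix_act_def vec_lambda_beta by (rule sum_norm_le)
  qed
  then have "norm (M *\<^sub>V v) \<le> (\<Sum>i\<in>(UNIV::'p set). \<Sum>j\<in>(UNIV::'p set). norm M * norm v)"
    by (intro order_trans [OF norm_vec_le_sum] sum_mono)
  also have "\<dots> = norm M * norm v * (real CARD('p))\<^sup>2"
    by (simp add: power2_eq_square)
  finally show ?thesis .
qed

lemma scaleC_0_right: "a *\<^sub>C 0 = 0"
  using scaleC_add_right [of a 0 0] by simp

lemma scaleC_sum_right: "a *\<^sub>C sum f S = (\<Sum>x\<in>S. a *\<^sub>C f x)"
  by (induction S rule: infinite_finite_induct) (simp_all add: scaleC_0_right scaleC_add_right)

lemma scaleC_0_left: "0 *\<^sub>C x = 0"
  using scaleC_add_left [of 0 0 x] by simp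

lemma scaleC_sum_left: "sum f S *\<^sub>C x = (\<Sum>y\<in>S. f y *\<^sub>C x)"
  by (induction S rule: infinite_finite_induct) (simp_all add: scaleC_0_left scaleC_add_left)

lemma scaleC_scaleR_left: "(r *\<^sub>R a) *\<^sub>C x = r *\<^sub>R (a *\<^sub>C x)"
  by (metis scaleC_of_real scaleC_scaleC scaleR_conv_of_real)

lemma scaleC_scaleR_right: "a *\<^sub>C (r *\<^sub>R x) = r *\<^sub>R (a *\<^sub>C x)"
  by (metis mult.commute scaleC_of_real scaleC_scaleC)

text \<open>Later proofs interpret this to get the product rule, continuity and limits for the
  action of matrices.\<close>

lemma bounded_bilinear_matrix_act:
  "bounded_bilinear ((*\<^sub>V) :: complex ^ 'p ^ 'p \<Rightarrow> 'v::complex_banach ^ 'p \<Rightarrow> 'v ^ 'p)"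
proof
  show "\<exists>K. \<forall>M (v :: 'v ^ 'p). norm (M *\<^sub>V v) \<le> norm M * norm v * K"
    using norm_matrix_act_le by blast
qed (auto simp: vec_eq_iff matrix_act_def scaleC_add_right scaleC_add_left sum.distrib
      scaleR_sum_right scaleC_scaleR_left scaleC_scaleR_right)

lemma matrix_act_assoc: "(M ** N) *\<^sub>V v = M *\<^sub>V N *\<^sub>V v"
proof (intro vec_eq_iff [THEN iffD2] allI)
  fix i
  have "((M ** N) *\<^sub>V v) $ i = (\<Sum>j\<in>UNIV. \<Sum>k\<in>UNIV. (M $ i $ k * N $ k $ j) *\<^sub>C (v $ j))"
    by (simp add: matrix_act_def matrix_matrix_mult_def scaleC_sum_left)
  also have "\<dots> = (\<Sum>k\<in>UNIV. \<Sum>j\<in>UNIV. (M $ i $ k * N $ k $ j) *\<^sub>C (v $ j))"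
    by (rule sum.swap)
  also have "\<dots> = (M *\<^sub>V N *\<^sub>V v) $ i"
    by (simp add: matrix_act_def scaleC_sum_right scaleC_scaleC)
  finally show "((M ** N) *\<^sub>V v) $ i = (M *\<^sub>V N *\<^sub>V v) $ i" .
qed

lemma scaleC_one: "1 *\<^sub>C x = x"
  using scaleC_of_real [of 1 x] by simp

lemma matrix_act_mat_1: "mat 1 *\<^sub>V v = v"
  by (simp add: vec_eq_iff matrix_act_def mat_def if_distrib [of "\<lambda>a. a *\<^sub>C _"] scaleC_0_left
      scaleC_one cong: if_cong)

section \<open>Inverse matrices and their derivative\<close>

lemma matrix_inv_mult:
  assumes "invertible M"
  shows "M ** matrix_inv M = mat 1" "matrix_inv M ** M = mat 1"
  using someI_ex [OF assms [unfolded invertible_def]] unfolding matrix_inv_def by auto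

text \<open>Difference quotients fit the algebraic identity for a difference of two inverses:
  dividing that identity by the increment leaves a product whose factors converge
  separately.\<close>

lemma has_vector_derivative_iff_tendsto:
  "(f has_vector_derivative D) (at x) \<longleftrightarrow> ((\<lambda>y. (f y - f x) /\<^sub>R (y - x)) \<longlongrightarrow> D) (at x)"
  for f :: "real \<Rightarrow> 'a::real_normed_vector"
proof -
  have "norm (((f y - f x) /\<^sub>R (y - x)) - D) = norm (f y - f x - (y - x) *\<^sub>R D) / norm (y - x)"
    if "y \<noteq> x" for y
  proof -
    have "((f y - f x) /\<^sub>R (y - x)) - D = (f y - f x - (y - x) *\<^sub>R D) /\<^sub>R (y - x)"
      using that by (simp add: scaleR_diff_right)
    then show ?thesis by (simp add: divide_inverse mult.commute)
  qed
  then have "((\<lambda>y. norm (((f y - f x) /\<^sub>R (y - x)) - D)) \<longlongrightarrow> 0) (at x) \<longleftrightarrow>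
    ((\<lambda>y. norm (f y - f x - (y - x) *\<^sub>R D) / norm (y - x)) \<longlongrightarrow> 0) (at x)"
    by (intro filterlim_cong refl) (auto simp: eventually_at_filter)
  then have "((\<lambda>y. norm (((f y - f x) /\<^sub>R (y - x)) - D)) \<longlongrightarrow> 0) (at x) \<longleftrightarrow>
      (f has_vector_derivative D) (at x)"
    by (simp only: has_vector_derivative_def has_derivative_iff_norm bounded_linear_scaleR_left simp_thms)
  then show ?thesis
    by (simp only: tendsto_norm_zero_iff LIM_zero_iff)
qed

text \<open>The identity \<open>B t - B x = - (B t ** (\<Phi> t - \<Phi> x) ** B x)\<close> for the
  inverses \<open>B\<close>, divided by \<open>t - x\<close>, converges to the claimed derivative
  once \<open>B\<close> is continuous at \<open>x\<close>. Most of the proof establishes that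
  continuity.\<close>

lemma matrix_inv_has_vector_derivative:
  fixes \<Phi> :: "real \<Rightarrow> complex ^ 'p ^ 'p"
  assumes D: "(\<Phi> has_vector_derivative D) (at x)" and inv: "\<And>t. invertible (\<Phi> t)"
  shows "((\<lambda>t. matrix_inv (\<Phi> t)) has_vector_derivative
      - (matrix_inv (\<Phi> x) ** D ** matrix_inv (\<Phi> x))) (at x)"
proof -
  interpret mm: bounded_bilinear "(**) :: complex ^ 'p ^ 'p \<Rightarrow> complex ^ 'p ^ 'p \<Rightarrow> _"
    by (rule bounded_bilinear_matrix_mult)
  define B where "B t = matrix_inv (\<Phi> t)" for t
  have B: "\<Phi> t ** B t = mat 1" "B t ** \<Phi> t = mat 1" for t
    using matrix_inv_mult [OF inv] by (auto simp: B_def)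
  have diff: "B t - B x = - (B t ** (\<Phi> t - \<Phi> x) ** B x)" for t
    by (simp add: mm.diff_left mm.diff_right B matrix_mul_assoc [symmetric])
  obtain K where K: "K > 0" "\<And>(M :: complex ^ 'p ^ 'p) (N :: complex ^ 'p ^ 'p). norm (M ** N) \<le> norm M * norm N * K"
    using mm.pos_bounded by blast
  have lim\<Phi>: "(\<Phi> \<longlongrightarrow> \<Phi> x) (at x)"
    using has_vector_derivative_continuous [OF D] unfolding continuous_within .
  define C where "C = K * K * norm (B x)"
  have C: "C \<ge> 0" using K by (simp add: C_def)
  have bound: "norm (B t - B x) \<le> norm (B t) * (C * norm (\<Phi> t - \<Phi> x))" for t
  proof -
    have "norm (B t - B x) \<le> norm (B t ** (\<Phi> t - \<Phi> x)) * norm (B x) * K"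
      using K(2) [of "B t ** (\<Phi> t - \<Phi> x)" "B x"] by (simp add: diff)
    also have "\<dots> \<le> norm (B t) * norm (\<Phi> t - \<Phi> x) * K * norm (B x) * K"
      using K by (intro mult_right_mono) auto
    finally show ?thesis by (simp add: C_def mult_ac)
  qed
  have lim0: "((\<lambda>t. C * norm (\<Phi> t - \<Phi> x)) \<longlongrightarrow> 0) (at x)"
    by (intro tendsto_mult_right_zero tendsto_norm_zero LIM_zero lim\<Phi>)
  \<comment> \<open>Once \<open>C * norm (\<Phi> t - \<Phi> x)\<close> is below 1/2, half of
    \<open>norm (B t)\<close> can be absorbed on the left, so \<open>norm (B t)\<close> is at most
    \<open>2 * norm (B x)\<close>. This local bound precedes the continuity of \<open>B\<close> and
    yields it.\<close>
  have ev: "\<forall>\<^sub>F t in at x. norm (B t - B x) \<le> 2 * norm (B x) * (C * norm (\<Phi> t - \<Phi> x))"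
  proof -
    have "\<forall>\<^sub>F t in at x. C * norm (\<Phi> t - \<Phi> x) < 1 / 2"
      using order_tendstoD(2) [OF lim0, of "1/2"] by simp
    then show ?thesis
    proof eventually_elim
      case (elim t)
      have "norm (B t) \<le> norm (B x) + norm (B t - B x)"
        using norm_triangle_ineq2 [of "B t" "B x"] by simp
      also have "norm (B t - B x) \<le> norm (B t) * (1 / 2)"
        using order_trans [OF bound [of t] mult_left_mono [OF less_imp_le [OF elim]]] by simp
      finally have "norm (B t) \<le> 2 * norm (B x)" by simp
      then show ?case
        by (rule order_trans [OF bound mult_right_mono [OF _ mult_nonneg_nonneg [OF C norm_ge_zero]]])
    qed
  qed
  have "((\<lambda>t. 2 * norm (B x) * (C * norm (\<Phi> t - \<Phi> x))) \<longlongrightarrow> 0) (at x)"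
    by (intro tendsto_mult_right_zero lim0)
  then have "((\<lambda>t. B t - B x) \<longlongrightarrow> 0) (at x)"
    by (rule Lim_null_comparison [OF ev])
  then have limB: "(B \<longlongrightarrow> B x) (at x)"
    by (simp add: LIM_zero_iff)
  have "((\<lambda>t. - (B t ** ((\<Phi> t - \<Phi> x) /\<^sub>R (t - x)) ** B x)) \<longlongrightarrow> - (B x ** D ** B x)) (at x)"
    using D unfolding has_vector_derivative_iff_tendsto
    by (intro tendsto_minus mm.tendsto limB tendsto_const)
  then show ?thesis
    unfolding has_vector_derivative_iff_tendsto B_def [symmetric]
    by (simp only: diff mm.scaleR_left mm.scaleR_right mm.minus_left scaleR_minus_right)
qed

section \<open>Integrals over the real line\<close>

text \<open>An interval contains the ball of radius B around 0 exactly when its endpoints lie at or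
  beyond -B and B. The integral over the line is thus a limit over intervals growing independently
  in both directions, which suits vector-valued improper integrals.\<close>

lemma has_integral_UNIV_real:
  fixes f :: "real \<Rightarrow> 'a::banach"
  shows "(f has_integral i) UNIV \<longleftrightarrow>
    (\<forall>e>0. \<exists>B>0. \<forall>a b. a \<le> - B \<longrightarrow> B \<le> b \<longrightarrow> (\<exists>z. (f has_integral z) {a..b} \<and> norm (z - i) < e))"
proof -
  have "ball 0 B \<subseteq> cbox a b \<longleftrightarrow> a \<le> - B \<and> B \<le> b" if "B > 0" for a b B :: real
  proof
    assume "ball 0 B \<subseteq> cbox a b"
    \<comment> \<open>The box is closed, so it also contains the endpoints -B and B of the open
      ball.\<close>
    then have "closure (ball 0 B) \<subseteq> cbox a b"
      by (rule closure_minimal) simp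
    then have "- B \<in> cbox a b" "B \<in> cbox a b"
      using that by (auto simp: subset_iff)
    then show "a \<le> - B \<and> B \<le> b" by auto
  qed auto
  then show ?thesis
    unfolding has_integral' [of f i UNIV] by (simp add: imp_conjL cong: conj_cong)
qed

text \<open>The substitution s = t - u, used to pass between kernels in \<open>t - s\<close> and
  convolution integrals in \<open>u\<close>.\<close>

lemma has_integral_UNIV_reflect:
  fixes f :: "real \<Rightarrow> 'a::banach"
  assumes "(f has_integral i) UNIV"
  shows "((\<lambda>u. f (t - u)) has_integral i) UNIV"
  unfolding has_integral_UNIV_real
proof (intro allI impI)
  fix e :: real assume "e > 0"
  then obtain B where B: "B > 0"
    "\<And>a b. a \<le> - B \<Longrightarrow> B \<le> b \<Longrightarrow> \<exists>z. (f has_integral z) {a..b} \<and> norm (z - i) < e"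
    using assms unfolding has_integral_UNIV_real by blast
  show "\<exists>B>0. \<forall>a b. a \<le> - B \<longrightarrow> B \<le> b \<longrightarrow>
    (\<exists>z. ((\<lambda>u. f (t - u)) has_integral z) {a..b} \<and> norm (z - i) < e)"
  \<comment> \<open>Enlarging \<open>B\<close> by the absolute value of \<open>t\<close> makes the
    reflected interval from \<open>t - b\<close> to \<open>t - a\<close> still contain
    [-B, B].\<close>
  proof (intro exI [of _ "B + \<bar>t\<bar>"] conjI allI impI)
    fix a b assume ab: "a \<le> - (B + \<bar>t\<bar>)" "B + \<bar>t\<bar> \<le> b"
    then have "t - b \<le> - B" "B \<le> t - a" by linarith+
    then obtain z where z: "(f has_integral z) {t - b..t - a}" "norm (z - i) < e"
      using B(2) by blast
    have "(\<lambda>x. (1 / - 1) *\<^sub>R x + - ((1 / - 1) *\<^sub>R t)) ` cbox (t - b) (t - a) = {a..b}"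
      using image_affinity_atLeastAtMost [of "-1" t "t - b" "t - a"] ab B by auto
    then have "((\<lambda>u. f (t - u)) has_integral z) {a..b}"
      using has_integral_affinity [of f z "t - b" "t - a" "-1" t] z(1) by (simp add: algebra_simps)
    with z show "\<exists>z. ((\<lambda>u. f (t - u)) has_integral z) {a..b} \<and> norm (z - i) < e" by blast
  qed (use B in auto)
qed

lemma has_integral_UNIV_LIMSEQ:
  fixes f :: "real \<Rightarrow> 'a::banach"
  assumes "(f has_integral i) UNIV"
  shows "(\<lambda>n. integral {- real n..real n} f) \<longlonglongrightarrow> i"
  unfolding tendsto_iff
proof (intro allI impI)
  fix e :: real assume "e > 0"
  then obtain B where B: "B > 0"
    "\<And>a b. a \<le> - B \<Longrightarrow> B \<le> b \<Longrightarrow> \<exists>z. (f has_integral z) {a..b} \<and> norm (z - i) < e"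
    using assms unfolding has_integral_UNIV_real by blast
  show "\<forall>\<^sub>F n in sequentially. dist (integral {- real n..real n} f) i < e"
    using eventually_ge_at_top [of "nat \<lceil>B\<rceil>"]
  proof eventually_elim
    case (elim n)
    then have "B \<le> real n" by linarith
    then show ?case
      using B(2) [of "- real n" "real n"] by (auto simp: dist_norm integral_unique)
  qed
qed

section \<open>Vector-valued integrals: estimates in an equivalent norm and evaluation by
  antiderivatives\<close>

lemma equivalent_norm_tendsto:
  assumes N: "equivalent_norm N" and f: "(f \<longlongrightarrow> l) F"
  shows "((\<lambda>x. N (f x)) \<longlongrightarrow> N l) F"
proof -
  obtain b where b: "\<And>x. N x \<le> b * norm x"
    using N unfolding equivalent_norm_def by blast
  have tri: "N (x + y) \<le> N x + N y" and hom: "N (r *\<^sub>R x) = \<bar>r\<bar> * N x" for x y r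
    using N unfolding equivalent_norm_def is_norm_def by auto
  \<comment> \<open>The triangle inequality used in both directions makes \<open>N\<close> Lipschitz
    with constant \<open>b\<close> for the library norm.\<close>
  have "\<bar>N x - N y\<bar> \<le> b * norm (x - y)" for x y
    using tri [of "x - y" y] tri [of "y - x" x] hom [of "-1" "x - y"] b [of "x - y"] by simp
  then have "\<forall>\<^sub>F x in F. norm (N (f x) - N l) \<le> b * norm (f x - l)"
    by simp
  moreover have "((\<lambda>x. b * norm (f x - l)) \<longlongrightarrow> 0) F"
    by (intro tendsto_mult_right_zero tendsto_norm_zero LIM_zero f)
  ultimately show ?thesis
    by (rule LIM_zero_cancel [OF Lim_null_comparison])
qed

text \<open>For Riemann sums the inequality is the triangle inequality together with homogeneity; it
  survives the limit along divisions of every box and then the limit over [-n, n]. Arguing with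
  \<open>N\<close> itself avoids any loss from comparing it with the library norm.\<close>

lemma equivalent_norm_integral_le:
  fixes f :: "real \<Rightarrow> 'a::banach"
  assumes N: "equivalent_norm N" and f: "(f has_integral i) UNIV" and g: "(g has_integral j) UNIV"
    and le: "\<And>x. N (f x) \<le> g x"
  shows "N i \<le> j"
proof -
  have N_0: "N 0 = 0" and tri: "N (x + y) \<le> N x + N y" and hom: "N (r *\<^sub>R x) = \<bar>r\<bar> * N x" for x y r
    using N unfolding equivalent_norm_def is_norm_def by auto
  have sum_le: "N (sum h S) \<le> (\<Sum>x\<in>S. N (h x))" for h :: "real \<times> real set \<Rightarrow> 'a" and S
    by (induction S rule: infinite_finite_induct) (auto simp: N_0 intro: order_trans [OF tri])
  have int: "f integrable_on cbox a b" "g integrable_on cbox a b" for a b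
    using f g by (meson has_integral_integrable integrable_on_subcbox subset_UNIV)+
  have "N (integral (cbox a b) f) \<le> integral (cbox a b) g" for a b
  proof (rule tendsto_le [OF division_filter_not_empty])
    show "((\<lambda>p. \<Sum>(x,k)\<in>p. measure lborel k *\<^sub>R g x) \<longlongrightarrow> integral (cbox a b) g) (division_filter (cbox a b))"
      using integrable_integral [OF int(2)] by (simp only: has_integral_cbox)
    show "((\<lambda>p. N (\<Sum>(x,k)\<in>p. measure lborel k *\<^sub>R f x)) \<longlongrightarrow> N (integral (cbox a b) f))
        (division_filter (cbox a b))"
      using integrable_integral [OF int(1)]
      by (intro equivalent_norm_tendsto [OF N]) (simp only: has_integral_cbox)
    have "N (\<Sum>(x,k)\<in>p. measure lborel k *\<^sub>R f x) \<le> (\<Sum>(x,k)\<in>p. measure lborel k *\<^sub>R g x)"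
      for p :: "(real \<times> real set) set"
      by (rule order_trans [OF sum_le], rule sum_mono) (auto simp: hom intro!: mult_left_mono le)
    then show "\<forall>\<^sub>F p in division_filter (cbox a b).
        N (\<Sum>(x,k)\<in>p. measure lborel k *\<^sub>R f x) \<le> (\<Sum>(x,k)\<in>p. measure lborel k *\<^sub>R g x)"
      by simp
  qed
  then have "N (integral {a..b} f) \<le> integral {a..b} g" for a b
    by (simp only: box_real)
  then show ?thesis
    by (intro LIMSEQ_le [OF equivalent_norm_tendsto [OF N has_integral_UNIV_LIMSEQ [OF f]]
          has_integral_UNIV_LIMSEQ [OF g]] exI allI impI)
qed

text \<open>By the fundamental theorem of calculus the part below \<open>t\<close> gives
  \<open>F t - l\<close> and the part above gives \<open>m - G t\<close>; convergence of the two
  antiderivatives replaces an integrability hypothesis. The break at \<open>t\<close> accommodates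
  the jump of the Green matrix on the diagonal.\<close>

lemma has_integral_UNIV_split:
  fixes F G :: "real \<Rightarrow> 'a::banach"
  assumes F: "\<And>s. (F has_vector_derivative f s) (at s)"
    and G: "\<And>s. (G has_vector_derivative g s) (at s)"
    and l: "(F \<longlongrightarrow> l) at_bot" and m: "(G \<longlongrightarrow> m) at_top"
  shows "((\<lambda>s. if s \<le> t then f s else g s) has_integral (F t - l) + (m - G t)) UNIV"
  unfolding has_integral_UNIV_real
proof (intro allI impI)
  fix e :: real assume e: "e > 0"
  obtain a0 where a0: "\<And>a. a \<le> a0 \<Longrightarrow> dist (F a) l < e / 2"
    using tendstoD [OF l, of "e / 2"] e by (auto simp: eventually_at_bot_linorder)
  obtain b0 where b0: "\<And>b. b0 \<le> b \<Longrightarrow> dist (G b) m < e / 2"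
    using tendstoD [OF m, of "e / 2"] e by (auto simp: eventually_at_top_linorder)
  show "\<exists>B>0. \<forall>a b. a \<le> - B \<longrightarrow> B \<le> b \<longrightarrow>
    (\<exists>z. ((\<lambda>s. if s \<le> t then f s else g s) has_integral z) {a..b} \<and>
      norm (z - (F t - l + (m - G t))) < e)"
  proof (intro exI [of _ "1 + \<bar>t\<bar> + \<bar>a0\<bar> + \<bar>b0\<bar>"] conjI allI impI)
    fix a b
    assume ab: "a \<le> - (1 + \<bar>t\<bar> + \<bar>a0\<bar> + \<bar>b0\<bar>)" "1 + \<bar>t\<bar> + \<bar>a0\<bar> + \<bar>b0\<bar> \<le> b"
    have "(f has_integral F t - F a) {a..t}" "(g has_integral G b - G t) {t..b}"
      using ab by (auto intro!: fundamental_theorem_of_calculus has_vector_derivative_at_within F G)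
    \<comment> \<open>The two branches may disagree at \<open>s = t\<close>, but a single point does
      not affect the integral over \<open>{t..b}\<close>.\<close>
    then have "((\<lambda>s. if s \<le> t then f s else g s) has_integral F t - F a) {a..t}"
      and "((\<lambda>s. if s \<le> t then f s else g s) has_integral G b - G t) {t..b}"
      by (auto elim!: has_integral_spike_finite [of "{t}", rotated 2] split: if_splits)
    then have int: "((\<lambda>s. if s \<le> t then f s else g s) has_integral (F t - F a) + (G b - G t)) {a..b}"
      using ab by (intro has_integral_combine [of a t b]) auto
    have "norm (((F t - F a) + (G b - G t)) - (F t - l + (m - G t))) = norm ((l - F a) + (G b - m))"
      by (simp add: algebra_simps)
    also have "\<dots> \<le> dist (F a) l + dist (G b) m"
      unfolding dist_norm using norm_triangle_ineq norm_minus_commute by metis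
    also have "\<dots> < e"
      using a0 [of a] b0 [of b] ab by fastforce
    finally show "\<exists>z. ((\<lambda>s. if s \<le> t then f s else g s) has_integral z) {a..b} \<and>
        norm (z - (F t - l + (m - G t))) < e"
      using int by blast
  qed auto
qed

text \<open>Each half-line contributes 1 / \<alpha>; this is the origin of the factor 2 / \<alpha>
  in the final bound.\<close>

lemma has_integral_exp_abs:
  fixes \<alpha> :: real
  assumes "\<alpha> > 0"
  shows "((\<lambda>s. exp (- \<alpha> * \<bar>t - s\<bar>)) has_integral 2 / \<alpha>) UNIV"
proof -
  have "((\<lambda>s. if s \<le> t then exp (\<alpha> * (s - t)) else exp (- \<alpha> * (s - t))) has_integral
      (exp (\<alpha> * (t - t)) / \<alpha> - 0) + (0 - (- exp (- \<alpha> * (t - t)) / \<alpha>))) UNIV"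
  proof (rule has_integral_UNIV_split [where F = "\<lambda>s. exp (\<alpha> * (s - t)) / \<alpha>"
        and G = "\<lambda>s. - exp (- \<alpha> * (s - t)) / \<alpha>"])
    show "((\<lambda>s. exp (\<alpha> * (s - t)) / \<alpha>) has_vector_derivative exp (\<alpha> * (s - t))) (at s)" for s
      using assms unfolding has_real_derivative_iff_has_vector_derivative [symmetric]
      by (auto intro!: derivative_eq_intros)
    show "((\<lambda>s. - exp (- \<alpha> * (s - t)) / \<alpha>) has_vector_derivative exp (- \<alpha> * (s - t))) (at s)" for s
      using assms unfolding has_real_derivative_iff_has_vector_derivative [symmetric]
      by (auto intro!: derivative_eq_intros)
    show "((\<lambda>s. exp (\<alpha> * (s - t)) / \<alpha>) \<longlongrightarrow> 0) at_bot"
      using assms by real_asymp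
    show "((\<lambda>s. - exp (- \<alpha> * (s - t)) / \<alpha>) \<longlongrightarrow> 0) at_top"
      using assms by real_asymp
  qed
  moreover have "(\<lambda>s. if s \<le> t then exp (\<alpha> * (s - t)) else exp (- \<alpha> * (s - t))) =
      (\<lambda>s. exp (- \<alpha> * \<bar>t - s\<bar>))"
    by (auto simp: fun_eq_iff algebra_simps abs_if)
  ultimately show ?thesis by simp
qed

section \<open>Almost automorphic functions\<close>

lemma almost_automorphicE:
  assumes "\<psi> \<in> almost_automorphic"
  obtains r \<psi>' where "strict_mono (r :: nat \<Rightarrow> nat)"
    and "\<And>t. (\<lambda>n. \<psi> (t + \<sigma> (r n))) \<longlonglongrightarrow> \<psi>' t" "\<And>t. (\<lambda>n. \<psi>' (t - \<sigma> (r n))) \<longlonglongrightarrow> \<psi> t"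
proof -
  have "\<exists>r. strict_mono r \<and> (\<exists>\<psi>'. \<forall>t. (\<lambda>n. \<psi> (t + \<sigma> (r n))) \<longlonglongrightarrow> \<psi>' t \<and>
      (\<lambda>n. \<psi>' (t - \<sigma> (r n))) \<longlonglongrightarrow> \<psi> t)"
    using assms unfolding almost_automorphic_def mem_Collect_eq by (elim conjE allE)
  then obtain r \<psi>' where r: "strict_mono r"
    and lim: "\<forall>t. (\<lambda>n. \<psi> (t + \<sigma> (r n))) \<longlonglongrightarrow> \<psi>' t \<and> (\<lambda>n. \<psi>' (t - \<sigma> (r n))) \<longlonglongrightarrow> \<psi> t"
    by (elim exE conjE) (rule that)
  show thesis
    by (rule that [OF r lim [rule_format, THEN conjunct1] lim [rule_format, THEN conjunct2]])
qed

lemma almost_automorphic_continuous: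
  "\<psi> \<in> almost_automorphic \<Longrightarrow> continuous_on UNIV \<psi>"
  by (simp add: almost_automorphic_def)

text \<open>Otherwise there are times \<open>\<sigma> n\<close> at which the norm exceeds n. Along
  the extracted subsequence the translates evaluated at 0 converge and so stay bounded, although the
  norm at \<open>\<sigma> (r n)\<close> exceeds \<open>r n\<close>, which is at least n.\<close>

lemma almost_automorphic_bounded:
  assumes "\<psi> \<in> almost_automorphic"
  obtains C where "\<And>t. norm (\<psi> t) \<le> C"
proof (rule ccontr)
  assume "\<not> thesis"
  then have "\<forall>n::nat. \<exists>t. \<not> norm (\<psi> t) \<le> real n" using that by blast
  then obtain \<sigma> where \<sigma>: "\<And>n::nat. \<not> norm (\<psi> (\<sigma> n)) \<le> real n" by metis
  obtain r \<psi>' where r: "strict_mono (r :: nat \<Rightarrow> nat)"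
    and lim: "\<And>t. (\<lambda>n. \<psi> (t + \<sigma> (r n))) \<longlonglongrightarrow> \<psi>' t"
      "\<And>t. (\<lambda>n. \<psi>' (t - \<sigma> (r n))) \<longlonglongrightarrow> \<psi> t"
    by (rule almost_automorphicE [OF assms, of \<sigma>]) (rule that)
  have "Bseq (\<lambda>n. \<psi> (\<sigma> (r n)))"
    using convergentI [OF lim(1) [of 0], THEN convergent_imp_Bseq] by simp
  then obtain C where C: "\<And>n. norm (\<psi> (\<sigma> (r n))) \<le> C"
    by (rule BseqE) blast
  obtain n :: nat where "C \<le> real n" using real_arch_simple by blast
  also have "real n \<le> real (r n)" using r by (simp add: seq_suble)
  also have "\<dots> < norm (\<psi> (\<sigma> (r n)))" using \<sigma> by (simp add: not_le)
  finally show False using C [of n] by simp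
qed

text \<open>A subsequence is extracted for \<open>A\<close> first and then refined for
  \<open>f\<close>; the limits for \<open>A\<close> persist under refinement. One subsequence then
  serves the matrix and the forcing term together.\<close>

lemma almost_automorphic_Pair:
  assumes A: "A \<in> almost_automorphic" and f: "f \<in> almost_automorphic"
  shows "(\<lambda>t. (A t, f t)) \<in> almost_automorphic"
  unfolding almost_automorphic_def mem_Collect_eq
proof (intro conjI allI)
  show "continuous_on UNIV (\<lambda>t. (A t, f t))"
    by (intro continuous_on_Pair almost_automorphic_continuous assms)
  fix \<sigma> :: "nat \<Rightarrow> real"
  obtain r A' where r: "strict_mono (r :: nat \<Rightarrow> nat)"
    and A': "\<And>t. (\<lambda>n. A (t + \<sigma> (r n))) \<longlonglongrightarrow> A' t" "\<And>t. (\<lambda>n. A' (t - \<sigma> (r n))) \<longlonglongrightarrow> A t"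
    by (rule almost_automorphicE [OF A, of \<sigma>]) (rule that)
  obtain q f' where q: "strict_mono (q :: nat \<Rightarrow> nat)"
    and f': "\<And>t. (\<lambda>n. f (t + \<sigma> (r (q n)))) \<longlonglongrightarrow> f' t" "\<And>t. (\<lambda>n. f' (t - \<sigma> (r (q n)))) \<longlonglongrightarrow> f t"
    by (rule almost_automorphicE [OF f, of "\<lambda>n. \<sigma> (r n)"]) (rule that)
  have "(\<lambda>n. A (t + \<sigma> (r (q n)))) \<longlonglongrightarrow> A' t" "(\<lambda>n. A' (t - \<sigma> (r (q n)))) \<longlonglongrightarrow> A t" for t
    using A' [THEN LIMSEQ_subseq_LIMSEQ, OF q] by (simp_all add: o_def)
  then show "\<exists>r. strict_mono r \<and> (\<exists>\<psi>'. \<forall>t. (\<lambda>n. (A (t + \<sigma> (r n)), f (t + \<sigma> (r n)))) \<longlonglongrightarrow> \<psi>' t \<and>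
      (\<lambda>n. \<psi>' (t - \<sigma> (r n))) \<longlonglongrightarrow> (A t, f t))"
    using f' strict_mono_o [OF r q]
    by (intro exI [of _ "r \<circ> q"] conjI exI [of _ "\<lambda>t. (A' t, f' t)"] allI)
      (auto simp: o_def intro!: tendsto_Pair)
qed

section \<open>Exponentially weighted integrals and the transfer of almost automorphy\<close>

lemma exp_abs_integrable:
  fixes \<alpha> :: real
  assumes "\<alpha> > 0"
  shows "(\<lambda>u. exp (- \<alpha> * \<bar>u\<bar>)) integrable_on UNIV"
  using has_integral_exp_abs [OF assms, of 0] by (auto simp: integrable_on_def)

lemma exp_abs_mult_integrable:
  fixes g :: "real \<Rightarrow> real"
  assumes \<alpha>: "\<alpha> > 0" and g: "continuous_on UNIV g" "\<And>u. \<bar>g u\<bar> \<le> C"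
  shows "(\<lambda>u. exp (- \<alpha> * \<bar>u\<bar>) * g u) integrable_on UNIV"
proof (rule integrable_on_all_intervals_integrable_bound)
  show "(\<lambda>u. exp (- \<alpha> * \<bar>u\<bar>) * C) integrable_on UNIV"
    by (intro integrable_on_mult_left exp_abs_integrable \<alpha>)
  show "norm (exp (- \<alpha> * \<bar>u\<bar>) * g u) \<le> exp (- \<alpha> * \<bar>u\<bar>) * C" for u
    using g(2) by (simp add: abs_mult)
  have "continuous_on UNIV (\<lambda>u. exp (- \<alpha> * \<bar>u\<bar>) * g u)"
    by (intro continuous_intros g)
  then have "(\<lambda>u. exp (- \<alpha> * \<bar>u\<bar>) * g u) integrable_on cbox a b" for a b
    by (rule integrable_continuous [OF continuous_on_subset]) simp
  then show "(\<lambda>u. if u \<in> UNIV then exp (- \<alpha> * \<bar>u\<bar>) * g u else 0) integrable_on cbox a b" for a b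
    by simp
qed

text \<open>The dominating function is a multiple of the integrable weight. Integrability of the
  limit belongs to the conclusion because limits of translates of an almost automorphic function may
  be discontinuous, so it cannot be had from continuity.\<close>

lemma exp_abs_dominated_convergence:
  fixes g :: "nat \<Rightarrow> real \<Rightarrow> real"
  assumes \<alpha>: "\<alpha> > 0" and int: "\<And>n. (\<lambda>u. exp (- \<alpha> * \<bar>u\<bar>) * g n u) integrable_on UNIV"
    and le: "\<And>n u. \<bar>g n u\<bar> \<le> C" and lim: "\<And>u. (\<lambda>n. g n u) \<longlonglongrightarrow> l u"
  shows "(\<lambda>u. exp (- \<alpha> * \<bar>u\<bar>) * l u) integrable_on UNIV"
    and "(\<lambda>n. integral UNIV (\<lambda>u. exp (- \<alpha> * \<bar>u\<bar>) * g n u)) \<longlonglongrightarrow>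
      integral UNIV (\<lambda>u. exp (- \<alpha> * \<bar>u\<bar>) * l u)"
proof -
  have bound: "(\<lambda>u. exp (- \<alpha> * \<bar>u\<bar>) * C) integrable_on UNIV"
    by (intro integrable_on_mult_left exp_abs_integrable \<alpha>)
  have le': "norm (exp (- \<alpha> * \<bar>u\<bar>) * g n u) \<le> exp (- \<alpha> * \<bar>u\<bar>) * C" for n u
    using le by (simp add: abs_mult)
  have lim': "(\<lambda>n. exp (- \<alpha> * \<bar>u\<bar>) * g n u) \<longlonglongrightarrow> exp (- \<alpha> * \<bar>u\<bar>) * l u" for u
    by (intro tendsto_mult_left lim)
  note dom = dominated_convergence [OF int bound le' lim']
  show "(\<lambda>u. exp (- \<alpha> * \<bar>u\<bar>) * l u) integrable_on UNIV"
    using dom(1) by blast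
  show "(\<lambda>n. integral UNIV (\<lambda>u. exp (- \<alpha> * \<bar>u\<bar>) * g n u)) \<longlonglongrightarrow>
      integral UNIV (\<lambda>u. exp (- \<alpha> * \<bar>u\<bar>) * l u)"
    using dom(2) by blast
qed

text \<open>Along a subsequence suited to \<open>H\<close>, the integrals bounding the increments of
  \<open>y\<close> tend to 0 by dominated convergence. The translates of \<open>y\<close> are
  therefore Cauchy, which defines the limit function, and letting one index go to infinity in the
  same estimate gives the return limit.\<close>

lemma almost_automorphic_if_modulus_le:
  fixes H :: "real \<Rightarrow> 'w::banach" and y :: "real \<Rightarrow> 'u::banach"
  assumes H: "H \<in> almost_automorphic" and y: "continuous_on UNIV y" and \<alpha>: "\<alpha> > 0" and K: "K \<ge> 0"
    and le: "\<And>t h. norm (y (t + h) - y t) \<le>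
      K * integral UNIV (\<lambda>u. exp (- \<alpha> * \<bar>u\<bar>) * norm (H (t + h - u) - H (t - u)))"
  shows "y \<in> almost_automorphic"
  unfolding almost_automorphic_def mem_Collect_eq
proof (intro conjI allI y)
  fix \<sigma> :: "nat \<Rightarrow> real"
  obtain r H' where r: "strict_mono (r :: nat \<Rightarrow> nat)"
    and H': "\<And>t. (\<lambda>n. H (t + \<sigma> (r n))) \<longlonglongrightarrow> H' t" "\<And>t. (\<lambda>n. H' (t - \<sigma> (r n))) \<longlonglongrightarrow> H t"
    by (rule almost_automorphicE [OF H, of \<sigma>]) (rule that)
  obtain C where C: "\<And>t. norm (H t) \<le> C"
    using almost_automorphic_bounded [OF H] by blast
  have C': "norm (H' t) \<le> C" for t
    using C by (intro LIMSEQ_le_const2 [OF tendsto_norm [OF H'(1)]]) auto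
  have diff_le: "\<bar>norm (a - b)\<bar> \<le> 2 * C" if "norm a \<le> C" "norm b \<le> C" for a b :: 'w
    using norm_triangle_ineq4 [of a b] that by simp
  define s where "s n = \<sigma> (r n)" for n
  have H's: "(\<lambda>n. H (t + s n - u)) \<longlonglongrightarrow> H' (t - u)" "(\<lambda>n. H' (t - s n - u)) \<longlonglongrightarrow> H (t - u)" for t u
    using H' [of "t - u"] unfolding s_def [symmetric] by (simp_all add: algebra_simps)
  have int: "(\<lambda>u. exp (- \<alpha> * \<bar>u\<bar>) * norm (H (a - u) - H (b - u))) integrable_on UNIV" for a b
  proof (rule exp_abs_mult_integrable [OF \<alpha>])
    show "continuous_on UNIV (\<lambda>u. norm (H (a - u) - H (b - u)))"
      by (intro continuous_intros continuous_on_compose2 [OF almost_automorphic_continuous [OF H]]) auto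
    show "\<bar>norm (H (a - u) - H (b - u))\<bar> \<le> 2 * C" for u
      by (intro diff_le C)
  qed
  have "\<exists>y'. (\<lambda>n. y (t + s n)) \<longlonglongrightarrow> y'" for t
  proof -
    define E where "E n = integral UNIV (\<lambda>u. exp (- \<alpha> * \<bar>u\<bar>) * norm (H (t + s n - u) - H' (t - u)))" for n
    \<comment> \<open>\<open>H'\<close> is known only as a pointwise limit, so integrability comes
      from letting m go to infinity in differences of two translates of \<open>H\<close>.\<close>
    have intE: "(\<lambda>u. exp (- \<alpha> * \<bar>u\<bar>) * norm (H (t + s n - u) - H' (t - u))) integrable_on UNIV" for n
      by (rule exp_abs_dominated_convergence(1) [where
            g = "\<lambda>m u. norm (H (t + s n - u) - H (t + s m - u))" and C = "2 * C"])
        (intro \<alpha> int diff_le C tendsto_intros H's)+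
    have "E \<longlonglongrightarrow> integral UNIV (\<lambda>u. exp (- \<alpha> * \<bar>u\<bar>) * norm (H' (t - u) - H' (t - u)))"
      unfolding E_def
      by (rule exp_abs_dominated_convergence(2) [where C = "2 * C"])
        (intro \<alpha> intE diff_le C C' tendsto_intros H's)+
    then have "(\<lambda>n. K * E n) \<longlonglongrightarrow> 0"
      by (intro tendsto_mult_right_zero) simp
    \<comment> \<open>The modulus estimate at base point \<open>t + s n\<close> with shift
      \<open>s m - s n\<close>, where \<open>H' (t - u)\<close> is inserted as an intermediate
      point.\<close>
    have yE: "norm (y (t + s m) - y (t + s n)) \<le> K * E m + K * E n" for m n
    proof -
      have "norm (y (t + s m) - y (t + s n)) \<le>
          K * integral UNIV (\<lambda>u. exp (- \<alpha> * \<bar>u\<bar>) * norm (H (t + s m - u) - H (t + s n - u)))"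
        using le [of "t + s n" "s m - s n"] by simp
      also have "\<dots> \<le> K * integral UNIV (\<lambda>u. exp (- \<alpha> * \<bar>u\<bar>) * norm (H (t + s m - u) - H' (t - u)) +
          exp (- \<alpha> * \<bar>u\<bar>) * norm (H (t + s n - u) - H' (t - u)))"
      proof (intro mult_left_mono [OF _ K] integral_le int integrable_add intE)
        fix u
        have "norm (H (t + s m - u) - H (t + s n - u)) \<le>
            norm (H (t + s m - u) - H' (t - u)) + norm (H (t + s n - u) - H' (t - u))"
          using norm_triangle_ineq4 [of "H (t + s m - u) - H' (t - u)" "H (t + s n - u) - H' (t - u)"]
          by simp
        then show "exp (- \<alpha> * \<bar>u\<bar>) * norm (H (t + s m - u) - H (t + s n - u)) \<le>
            exp (- \<alpha> * \<bar>u\<bar>) * norm (H (t + s m - u) - H' (t - u)) +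
            exp (- \<alpha> * \<bar>u\<bar>) * norm (H (t + s n - u) - H' (t - u))"
          unfolding distrib_left [symmetric] by (intro mult_left_mono) auto
      qed
      also have "\<dots> = K * E m + K * E n"
        unfolding E_def by (simp only: integral_add [OF intE intE] distrib_left)
      finally show ?thesis .
    qed
    have "Cauchy (\<lambda>n. y (t + s n))"
    proof (rule metric_CauchyI)
      fix e :: real assume "e > 0"
      then have "\<forall>\<^sub>F n in sequentially. K * E n < e / 2"
        using order_tendstoD(2) [OF \<open>(\<lambda>n. K * E n) \<longlonglongrightarrow> 0\<close>, of "e / 2"] by simp
      then obtain M where M: "\<And>n. n \<ge> M \<Longrightarrow> K * E n < e / 2"
        unfolding eventually_sequentially by blast
      show "\<exists>M. \<forall>m\<ge>M. \<forall>n\<ge>M. dist (y (t + s m)) (y (t + s n)) < e"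
        unfolding dist_norm
      proof (intro exI allI impI)
        fix m n assume "M \<le> m" "M \<le> n"
        then show "norm (y (t + s m) - y (t + s n)) < e"
          using yE [of m n] M [of m] M [of n] by linarith
      qed
    qed
    then show ?thesis
      by (simp add: Cauchy_convergent_iff convergent_def)
  qed
  then obtain y' where y': "\<And>t. (\<lambda>n. y (t + s n)) \<longlonglongrightarrow> y' t" by metis
  have "(\<lambda>n. y' (t - s n)) \<longlonglongrightarrow> y t" for t
  proof -
    define F where "F n = integral UNIV (\<lambda>u. exp (- \<alpha> * \<bar>u\<bar>) * norm (H' (t - s n - u) - H (t - u)))" for n
    \<comment> \<open>Here n is fixed and m goes to infinity: the translates of \<open>H\<close> by
      \<open>s m\<close> at \<open>t - s n - u\<close> converge to \<open>H'\<close> there.\<close>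
    have F: "(\<lambda>u. exp (- \<alpha> * \<bar>u\<bar>) * norm (H' (t - s n - u) - H (t - u))) integrable_on UNIV"
      "(\<lambda>m. integral UNIV (\<lambda>u. exp (- \<alpha> * \<bar>u\<bar>) * norm (H (t - s n + s m - u) - H (t - u)))) \<longlonglongrightarrow> F n" for n
      unfolding F_def
      by (rule exp_abs_dominated_convergence [where
            g = "\<lambda>m u. norm (H (t - s n + s m - u) - H (t - u))" and C = "2 * C"],
          (intro \<alpha> int diff_le C tendsto_intros H's)+)+
    have "F \<longlonglongrightarrow> integral UNIV (\<lambda>u. exp (- \<alpha> * \<bar>u\<bar>) * norm (H (t - u) - H (t - u)))"
      unfolding F_def
      by (rule exp_abs_dominated_convergence(2) [where C = "2 * C"])
        (intro \<alpha> F diff_le C C' tendsto_intros H's)+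
    then have KF: "(\<lambda>n. K * F n) \<longlonglongrightarrow> 0"
      by (intro tendsto_mult_right_zero) simp
    \<comment> \<open>The modulus estimate at \<open>t\<close> with shift \<open>s m - s n\<close>,
      in the limit of m to infinity.\<close>
    have yF: "norm (y' (t - s n) - y t) \<le> K * F n" for n
    proof (rule LIMSEQ_le)
      show "(\<lambda>m. norm (y (t - s n + s m) - y t)) \<longlonglongrightarrow> norm (y' (t - s n) - y t)"
        by (intro tendsto_intros y')
      show "(\<lambda>m. K * integral UNIV (\<lambda>u. exp (- \<alpha> * \<bar>u\<bar>) * norm (H (t - s n + s m - u) - H (t - u))))
          \<longlonglongrightarrow> K * F n"
        by (intro tendsto_mult_left F)
      show "\<exists>M. \<forall>m\<ge>M. norm (y (t - s n + s m) - y t) \<le>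
          K * integral UNIV (\<lambda>u. exp (- \<alpha> * \<bar>u\<bar>) * norm (H (t - s n + s m - u) - H (t - u)))"
        using le [of t "s m - s n" for m] by (simp add: algebra_simps)
    qed
    have "(\<lambda>n. y' (t - s n) - y t) \<longlonglongrightarrow> 0"
      using yF by (intro Lim_null_comparison [OF _ KF] always_eventually allI)
    then show ?thesis by (rule LIM_zero_cancel)
  qed
  then show "\<exists>r. strict_mono r \<and> (\<exists>\<psi>'. \<forall>t. (\<lambda>n. y (t + \<sigma> (r n))) \<longlonglongrightarrow> \<psi>' t \<and>
      (\<lambda>n. \<psi>' (t - \<sigma> (r n))) \<longlonglongrightarrow> y t)"
    using r y' unfolding s_def by (intro exI [of _ r] exI [of _ y'] conjI allI)
qed

section \<open>Bounded solutions and the Green matrix\<close>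

lemma continuous_antiderivative_exists:
  fixes g :: "real \<Rightarrow> 'a::banach"
  assumes g: "continuous_on UNIV g"
  obtains \<psi> where "\<And>t. (\<psi> has_vector_derivative g t) (at t)"
proof -
  define \<psi> where "\<psi> t = (if 0 \<le> t then integral {0..t} g else - integral {t..0} g)" for t
  have int: "g integrable_on {a..b}" for a b
    by (rule integrable_continuous_real [OF continuous_on_subset [OF g]]) simp
  have "(\<psi> has_vector_derivative g t) (at t)" for t
  proof -
    \<comment> \<open>This base point lies to the left of both 0 and \<open>t\<close>, so near
      \<open>t\<close> the signed integral \<open>\<psi>\<close> is the ordinary integral from
      \<open>a\<close> minus a constant.\<close>
    define a where "a = - \<bar>t\<bar> - 1"
    have \<psi>: "\<psi> x = integral {a..x} g - integral {a..0} g" if "x \<in> {a<..<- a}" for x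
    proof (cases "0 \<le> x")
      case True
      then show ?thesis
        using Henstock_Kurzweil_Integration.integral_combine [of a 0 x g] int by (simp add: \<psi>_def a_def algebra_simps)
    next
      case False
      then show ?thesis
        using Henstock_Kurzweil_Integration.integral_combine [of a x 0 g] int that by (simp add: \<psi>_def algebra_simps)
    qed
    have "((\<lambda>x. integral {a..x} g) has_vector_derivative g t) (at t within {a..- a})"
      by (rule integral_has_vector_derivative [OF continuous_on_subset [OF g]]) (auto simp: a_def)
    then have "((\<lambda>x. integral {a..x} g) has_vector_derivative g t) (at t)"
      by (simp add: at_within_Icc_at a_def)
    then have "((\<lambda>x. integral {a..x} g - integral {a..0} g) has_vector_derivative g t) (at t)"
      by (simp add: has_vector_derivative_diff_const)
    then show ?thesis
      by (rule has_vector_derivative_transform_within_open [where S = "{a<..<- a}"])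
        (auto simp: a_def \<psi> [unfolded a_def])
  qed
  then show thesis by (rule that)
qed

text \<open>The primitive \<open>\<phi>\<close> of the bounding exponential that vanishes at
  infinity controls increments: beyond a they are at most \<open>- \<phi> a\<close>, which tends to
  0. The Cauchy criterion then supplies the limit.\<close>

lemma convergent_at_top_if_exp_derivative:
  fixes F :: "real \<Rightarrow> 'a::banach"
  assumes \<alpha>: "\<alpha> > 0" and F: "\<And>s. (F has_vector_derivative f s) (at s)"
    and le: "\<And>s. s > 0 \<Longrightarrow> norm (f s) \<le> C * exp (- \<alpha> * s)"
  obtains l where "(F \<longlongrightarrow> l) at_top"
proof -
  define \<phi> where "\<phi> s = - C / \<alpha> * exp (- \<alpha> * s)" for s
  \<comment> \<open>The sign of \<open>C\<close> is forced by the bound at s = 1.\<close>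
  have C: "C \<ge> 0"
    using order_trans [OF norm_ge_zero le [of 1]] by (simp add: zero_le_mult_iff)
  have lim\<phi>: "(\<phi> \<longlongrightarrow> 0) at_top"
    unfolding \<phi>_def using \<alpha> by real_asymp
  have diff: "norm (F b - F a) \<le> - \<phi> a" if "0 \<le> a" "a \<le> b" for a b
  proof (cases "a = b")
    case True
    then show ?thesis using C \<alpha> by (simp add: \<phi>_def)
  next
    case False
    have "norm (F b - F a) \<le> \<phi> b - \<phi> a"
    proof (rule differentiable_bound_general)
      show "a < b" using False that by simp
      show "continuous_on {a..b} F"
        using F by (meson continuous_at_imp_continuous_on has_vector_derivative_continuous)
      show "continuous_on {a..b} \<phi>"
        unfolding \<phi>_def by (intro continuous_intros)
      show "(F has_vector_derivative f s) (at s)" for s by (rule F)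
      show "(\<phi> has_vector_derivative C * exp (- \<alpha> * s)) (at s)" for s
        unfolding \<phi>_def has_real_derivative_iff_has_vector_derivative [symmetric]
        using \<alpha> by (auto intro!: derivative_eq_intros)
      show "norm (f s) \<le> C * exp (- \<alpha> * s)" if "a < s" for s
        using that \<open>0 \<le> a\<close> by (intro le) simp
    qed
    also have "\<dots> \<le> - \<phi> a"
      using C \<alpha> by (simp add: \<phi>_def)
    finally show ?thesis .
  qed
  have "Cauchy (\<lambda>n. F (real n))"
  proof (rule metric_CauchyI)
    fix e :: real assume "e > 0"
    have "\<forall>\<^sub>F x in at_top. - e / 2 < \<phi> x"
      using order_tendstoD(1) [OF lim\<phi>, of "- e / 2"] \<open>e > 0\<close> by simp
    then obtain X where X: "\<And>x. x \<ge> X \<Longrightarrow> - e / 2 < \<phi> x"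
      unfolding eventually_at_top_linorder by blast
    define M where "M = nat \<lceil>X\<rceil>"
    have "dist (F (real m)) (F (real M)) < e / 2" if "m \<ge> M" for m
      using diff [of "real M" "real m"] X [of "real M"] that by (simp add: dist_norm M_def) linarith
    then show "\<exists>M. \<forall>m\<ge>M. \<forall>n\<ge>M. dist (F (real m)) (F (real n)) < e"
      using dist_triangle_half_l by blast
  qed
  then obtain l where l: "(\<lambda>n. F (real n)) \<longlonglongrightarrow> l"
    by (auto simp: Cauchy_convergent_iff convergent_def)
  \<comment> \<open>The limit is so far known along the integers only; letting n go to infinity in
    \<open>diff\<close> extends it to real \<open>s\<close>, with a rate.\<close>
  have "norm (F s - l) \<le> - \<phi> s" if "s \<ge> 0" for s
  proof (rule LIMSEQ_le_const2)
    show "(\<lambda>n. norm (F s - F (real n))) \<longlonglongrightarrow> norm (F s - l)"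
      by (intro tendsto_intros l)
    show "\<exists>M. \<forall>n\<ge>M. norm (F s - F (real n)) \<le> - \<phi> s"
    proof (intro exI allI impI)
      fix n assume "nat \<lceil>s\<rceil> \<le> n"
      then have "s \<le> real n" by linarith
      then show "norm (F s - F (real n)) \<le> - \<phi> s"
        using diff [OF that, of "real n"] by (simp add: norm_minus_commute [of "F s"])
    qed
  qed
  then have "\<forall>\<^sub>F s in at_top. norm (F s - l) \<le> - \<phi> s"
    using eventually_ge_at_top [of 0] by (rule eventually_mono [rotated]) 
  moreover have "((\<lambda>s. - \<phi> s) \<longlongrightarrow> 0) at_top"
    using tendsto_minus [OF lim\<phi>] by simp
  ultimately have "((\<lambda>s. F s - l) \<longlongrightarrow> 0) at_top"
    by (rule Lim_null_comparison)
  then show thesis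
    by (rule that [OF LIM_zero_cancel])
qed

text \<open>Time reversal reduces this to the limit at plus infinity.\<close>

lemma convergent_at_bot_if_exp_derivative:
  fixes F :: "real \<Rightarrow> 'a::banach"
  assumes \<alpha>: "\<alpha> > 0" and F: "\<And>s. (F has_vector_derivative f s) (at s)"
    and le: "\<And>s. s < 0 \<Longrightarrow> norm (f s) \<le> C * exp (\<alpha> * s)"
  obtains l where "(F \<longlongrightarrow> l) at_bot"
proof -
  have "((\<lambda>s. F (- s)) has_vector_derivative - f (- s)) (at s)" for s
  proof -
    have "((\<lambda>s. - s) has_vector_derivative - 1) (at s)"
      by (auto intro!: derivative_eq_intros)
    then show ?thesis
      using vector_diff_chain_at [of uminus "- 1" s F "f (- s)"] F [of "- s"] by (simp add: o_def)
  qed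
  moreover have "norm (- f (- s)) \<le> C * exp (- \<alpha> * s)" if "s > 0" for s
    using le [of "- s"] that by simp
  ultimately obtain l where "((\<lambda>s. F (- s)) \<longlongrightarrow> l) at_top"
    by (rule convergent_at_top_if_exp_derivative [OF \<alpha>, of "\<lambda>s. F (- s)"])
  then show thesis
    by (intro that [of l]) (simp only: filterlim_at_bot_mirror)
qed

section \<open>Variation of constants with the Green matrix\<close>

lemma fundamental_matrix_cancel:
  assumes "fundamental_matrix A \<Phi>"
  shows "\<Phi> t *\<^sub>V matrix_inv (\<Phi> t) *\<^sub>V v = v" "matrix_inv (\<Phi> t) *\<^sub>V \<Phi> t *\<^sub>V v = v"
proof -
  have "invertible (\<Phi> t)"
    using assms by (simp add: fundamental_matrix_def)
  note inv = matrix_inv_mult [OF this]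
  show "\<Phi> t *\<^sub>V matrix_inv (\<Phi> t) *\<^sub>V v = v" "matrix_inv (\<Phi> t) *\<^sub>V \<Phi> t *\<^sub>V v = v"
    by (simp_all only: matrix_act_assoc [symmetric] inv matrix_act_mat_1)
qed

text \<open>In the formula for the derivative of an inverse, the factor \<Phi> from the equation
  cancels against the last inverse. Differentiating
  \<open>matrix_inv (\<Phi> t) *\<^sub>V w t\<close> for a solution \<open>w\<close> then eliminates
  the terms with \<open>A\<close>.\<close>

lemma fundamental_matrix_inv_derivative:
  assumes "fundamental_matrix A \<Phi>"
  shows "((\<lambda>t. matrix_inv (\<Phi> t)) has_vector_derivative - (matrix_inv (\<Phi> t) ** A t)) (at t)"
proof -
  have "(\<Phi> has_vector_derivative A t ** \<Phi> t) (at t)" "\<And>t. invertible (\<Phi> t)"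
    using assms unfolding fundamental_matrix_def by auto
  from matrix_inv_has_vector_derivative [OF this] this(2)
  show ?thesis
    by (simp add: matrix_mul_assoc [symmetric] matrix_inv_mult)
qed

lemma matrix_act_green:
  "green_matrix \<Phi> P t s *\<^sub>V v =
    (if s \<le> t then \<Phi> t *\<^sub>V P *\<^sub>V matrix_inv (\<Phi> s) *\<^sub>V v
     else - (\<Phi> t *\<^sub>V (mat 1 - P) *\<^sub>V matrix_inv (\<Phi> s) *\<^sub>V v))"
  by (simp add: green_matrix_def matrix_act_assoc
      bounded_bilinear.minus_left [OF bounded_bilinear_matrix_act])

text \<open>As a function of \<open>s\<close>, the integrand is the derivative of
  \<open>\<Phi> t *\<^sub>V P *\<^sub>V \<psi> s\<close> below \<open>t\<close> and of
  \<open>- (\<Phi> t *\<^sub>V (mat 1 - P) *\<^sub>V \<psi> s)\<close> above it. Since P and I - P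
  sum to the identity, the boundary terms at \<open>t\<close> add up to
  \<open>\<Phi> t *\<^sub>V \<psi> t\<close>.\<close>

lemma has_integral_green:
  fixes \<psi> :: "real \<Rightarrow> 'v::complex_banach ^ 'p"
  assumes "\<And>s. (\<psi> has_vector_derivative matrix_inv (\<Phi> s) *\<^sub>V g s) (at s)"
    and "((\<lambda>s. P *\<^sub>V \<psi> s) \<longlongrightarrow> p) at_bot" "((\<lambda>s. (mat 1 - P) *\<^sub>V \<psi> s) \<longlongrightarrow> q) at_top"
  shows "((\<lambda>s. green_matrix \<Phi> P t s *\<^sub>V g s) has_integral \<Phi> t *\<^sub>V (\<psi> t - p - q)) UNIV"
proof -
  interpret act: bounded_bilinear "(*\<^sub>V) :: complex ^ 'p ^ 'p \<Rightarrow> 'v ^ 'p \<Rightarrow> 'v ^ 'p"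
    by (rule bounded_bilinear_matrix_act)
  note deriv = bounded_linear.has_vector_derivative [OF act.bounded_linear_right]
  have "((\<lambda>s. if s \<le> t then \<Phi> t *\<^sub>V P *\<^sub>V matrix_inv (\<Phi> s) *\<^sub>V g s
        else - (\<Phi> t *\<^sub>V (mat 1 - P) *\<^sub>V matrix_inv (\<Phi> s) *\<^sub>V g s)) has_integral
      (\<Phi> t *\<^sub>V P *\<^sub>V \<psi> t - \<Phi> t *\<^sub>V p) +
      (- (\<Phi> t *\<^sub>V q) - - (\<Phi> t *\<^sub>V (mat 1 - P) *\<^sub>V \<psi> t))) UNIV"
    by (rule has_integral_UNIV_split [where F = "\<lambda>s. \<Phi> t *\<^sub>V P *\<^sub>V \<psi> s"
          and G = "\<lambda>s. - (\<Phi> t *\<^sub>V (mat 1 - P) *\<^sub>V \<psi> s)"])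
      (intro deriv has_vector_derivative_minus assms tendsto_minus act.tendsto tendsto_const)+
  also have "(\<Phi> t *\<^sub>V P *\<^sub>V \<psi> t - \<Phi> t *\<^sub>V p) +
      (- (\<Phi> t *\<^sub>V q) - - (\<Phi> t *\<^sub>V (mat 1 - P) *\<^sub>V \<psi> t)) = \<Phi> t *\<^sub>V (\<psi> t - p - q)"
    by (simp add: act.diff_left act.diff_right matrix_act_mat_1)
  finally show ?thesis
    by (simp only: matrix_act_green)
qed

text \<open>Taking t = 0 in the Green bound and multiplying by the inverse of \<Phi>(0) removes the
  left factor of the Green matrix. For s < 0 this leaves P times the inverse of \<Phi>(s), for s > 0
  it leaves I - P times that inverse, up to sign.\<close>

lemma dichotomy_decay:
  assumes \<Phi>: "fundamental_matrix A \<Phi>"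
    and G: "\<And>t s (v :: 'v::complex_banach ^ 'p). norm (green_matrix \<Phi> P t s *\<^sub>V v) \<le> K * exp (- \<alpha> * \<bar>t - s\<bar>) * norm v"
  obtains C where "C \<ge> 0"
    and "\<And>s (v :: 'v ^ 'p). s < 0 \<Longrightarrow>
      norm (P *\<^sub>V matrix_inv (\<Phi> s) *\<^sub>V v) \<le> C * exp (\<alpha> * s) * norm v"
    and "\<And>s (v :: 'v ^ 'p). s > 0 \<Longrightarrow>
      norm ((mat 1 - P) *\<^sub>V matrix_inv (\<Phi> s) *\<^sub>V v) \<le> C * exp (- \<alpha> * s) * norm v"
proof -
  interpret act: bounded_bilinear "(*\<^sub>V) :: complex ^ 'p ^ 'p \<Rightarrow> 'v ^ 'p \<Rightarrow> 'v ^ 'p"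
    by (rule bounded_bilinear_matrix_act)
  obtain k where k: "k > 0" "\<And>M (v :: 'v ^ 'p). norm (M *\<^sub>V v) \<le> norm M * norm v * k"
    using act.pos_bounded by blast
  define B where "B = norm (matrix_inv (\<Phi> 0)) * k"
  have B: "B \<ge> 0" using k by (simp add: B_def)
  \<comment> \<open>No sign of \<open>K\<close> is given; the absolute value keeps the resulting
    constant nonnegative.\<close>
  have *: "norm (matrix_inv (\<Phi> 0) *\<^sub>V green_matrix \<Phi> P 0 s *\<^sub>V v) \<le>
      B * \<bar>K\<bar> * exp (- \<alpha> * \<bar>s\<bar>) * norm v" for s and v :: "'v ^ 'p"
  proof -
    have "norm (matrix_inv (\<Phi> 0) *\<^sub>V green_matrix \<Phi> P 0 s *\<^sub>V v) \<le> B * norm (green_matrix \<Phi> P 0 s *\<^sub>V v)"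
      using k(2) [of "matrix_inv (\<Phi> 0)" "green_matrix \<Phi> P 0 s *\<^sub>V v"] by (simp add: B_def mult_ac)
    also have "norm (green_matrix \<Phi> P 0 s *\<^sub>V v) \<le> \<bar>K\<bar> * exp (- \<alpha> * \<bar>s\<bar>) * norm v"
      using order_trans [OF G [of 0 s v], of "\<bar>K\<bar> * exp (- \<alpha> * \<bar>s\<bar>) * norm v"]
      by (simp add: mult_right_mono)
    finally show ?thesis using B by (simp add: mult_left_mono mult.assoc)
  qed
  have "norm (P *\<^sub>V matrix_inv (\<Phi> s) *\<^sub>V v) \<le> B * \<bar>K\<bar> * exp (\<alpha> * s) * norm v"
    if "s < 0" for s and v :: "'v ^ 'p"
    using * [of s v] that by (simp add: matrix_act_green fundamental_matrix_cancel [OF \<Phi>])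
  moreover have "norm ((mat 1 - P) *\<^sub>V matrix_inv (\<Phi> s) *\<^sub>V v) \<le> B * \<bar>K\<bar> * exp (- \<alpha> * s) * norm v"
    if "s > 0" for s and v :: "'v ^ 'p"
    using * [of s v] that
    by (simp add: matrix_act_green act.minus_right fundamental_matrix_cancel [OF \<Phi>])
  ultimately show thesis
    using B by (intro that [of "B * \<bar>K\<bar>"]) auto
qed

text \<open>Pulling \<open>w\<close> back to \<open>\<psi>\<close> cancels the homogeneous part of
  the equation. Boundedness of \<open>w\<close> and the dichotomy decay make both limits at infinity
  zero, so no correction term remains. This serves uniqueness as well as the estimate for
  translates.\<close>

lemma bounded_solution_has_integral_green:
  fixes w g :: "real \<Rightarrow> 'v::complex_banach ^ 'p"
  assumes \<Phi>: "fundamental_matrix A \<Phi>" and \<alpha>: "\<alpha> > 0"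
    and G: "\<And>t s (v :: 'v ^ 'p). norm (green_matrix \<Phi> P t s *\<^sub>V v) \<le> K * exp (- \<alpha> * \<bar>t - s\<bar>) * norm v"
    and w: "linear_ode_solution A g w" and bounded: "\<And>t. norm (w t) \<le> B"
  shows "((\<lambda>s. green_matrix \<Phi> P t s *\<^sub>V g s) has_integral w t) UNIV"
proof -
  interpret act: bounded_bilinear "(*\<^sub>V) :: complex ^ 'p ^ 'p \<Rightarrow> 'v ^ 'p \<Rightarrow> 'v ^ 'p"
    by (rule bounded_bilinear_matrix_act)
  define \<psi> where "\<psi> s = matrix_inv (\<Phi> s) *\<^sub>V w s" for s
  obtain C where C: "C \<ge> 0"
    "\<And>s (v :: 'v ^ 'p). s < 0 \<Longrightarrow>
      norm (P *\<^sub>V matrix_inv (\<Phi> s) *\<^sub>V v) \<le> C * exp (\<alpha> * s) * norm v"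
    "\<And>s (v :: 'v ^ 'p). s > 0 \<Longrightarrow>
      norm ((mat 1 - P) *\<^sub>V matrix_inv (\<Phi> s) *\<^sub>V v) \<le> C * exp (- \<alpha> * s) * norm v"
    by (rule dichotomy_decay [OF \<Phi> G]) (rule that)
  have "(\<psi> has_vector_derivative matrix_inv (\<Phi> s) *\<^sub>V g s) (at s)" for s
  proof -
    have "(w has_vector_derivative A s *\<^sub>V w s + g s) (at s)"
      using w by (simp add: linear_ode_solution_def)
    from act.has_vector_derivative [OF fundamental_matrix_inv_derivative [OF \<Phi>] this]
    show ?thesis
      unfolding \<psi>_def by (simp add: act.add_right act.minus_left matrix_act_assoc)
  qed
  moreover have "((\<lambda>s. P *\<^sub>V \<psi> s) \<longlongrightarrow> 0) at_bot"
  proof (rule Lim_null_comparison)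
    show "\<forall>\<^sub>F s in at_bot. norm (P *\<^sub>V \<psi> s) \<le> C * exp (\<alpha> * s) * B"
      using eventually_gt_at_bot [of 0] unfolding \<psi>_def
    proof eventually_elim
      case (elim s)
      have "C * exp (\<alpha> * s) * norm (w s) \<le> C * exp (\<alpha> * s) * B"
        using C(1) by (intro mult_left_mono bounded) auto
      with C(2) [OF elim, of "w s"] show ?case by simp
    qed
    show "((\<lambda>s. C * exp (\<alpha> * s) * B) \<longlongrightarrow> 0) at_bot"
      using \<alpha> by real_asymp
  qed
  moreover have "((\<lambda>s. (mat 1 - P) *\<^sub>V \<psi> s) \<longlongrightarrow> 0) at_top"
  proof (rule Lim_null_comparison)
    show "\<forall>\<^sub>F s in at_top. norm ((mat 1 - P) *\<^sub>V \<psi> s) \<le> C * exp (- \<alpha> * s) * B"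
      using eventually_gt_at_top [of 0] unfolding \<psi>_def
    proof eventually_elim
      case (elim s)
      have "C * exp (- \<alpha> * s) * norm (w s) \<le> C * exp (- \<alpha> * s) * B"
        using C(1) by (intro mult_left_mono bounded) auto
      with C(3) [OF elim, of "w s"] show ?case by simp
    qed
    show "((\<lambda>s. C * exp (- \<alpha> * s) * B) \<longlongrightarrow> 0) at_top"
      using \<alpha> by real_asymp
  qed
  ultimately have "((\<lambda>s. green_matrix \<Phi> P t s *\<^sub>V g s) has_integral \<Phi> t *\<^sub>V (\<psi> t - 0 - 0)) UNIV"
    by (rule has_integral_green)
  then show ?thesis
    by (simp add: \<psi>_def fundamental_matrix_cancel [OF \<Phi>])
qed

text \<open>For an antiderivative \<open>\<psi>\<close> of the pulled-back forcing term, the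
  dichotomy makes the derivatives of P \<psi> and (I - P) \<psi> exponentially small at minus and
  plus infinity respectively. Both limits therefore exist, and the Green integral can be
  evaluated.\<close>

lemma exists_solution_green:
  fixes f :: "real \<Rightarrow> 'v::complex_banach ^ 'p"
  assumes \<Phi>: "fundamental_matrix A \<Phi>" and \<alpha>: "\<alpha> > 0"
    and G: "\<And>t s (v :: 'v ^ 'p). norm (green_matrix \<Phi> P t s *\<^sub>V v) \<le> K * exp (- \<alpha> * \<bar>t - s\<bar>) * norm v"
    and f: "continuous_on UNIV f" "\<And>t. norm (f t) \<le> B"
  obtains y where "linear_ode_solution A f y"
    and "\<And>t. ((\<lambda>s. green_matrix \<Phi> P t s *\<^sub>V f s) has_integral y t) UNIV"
proof -
  interpret act: bounded_bilinear "(*\<^sub>V) :: complex ^ 'p ^ 'p \<Rightarrow> 'v ^ 'p \<Rightarrow> 'v ^ 'p"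
    by (rule bounded_bilinear_matrix_act)
  note deriv = bounded_linear.has_vector_derivative [OF act.bounded_linear_right]
  have "continuous_on UNIV (\<lambda>t. matrix_inv (\<Phi> t))"
    using has_vector_derivative_continuous [OF fundamental_matrix_inv_derivative [OF \<Phi>]]
    by (simp add: continuous_on_eq_continuous_at)
  then have "continuous_on UNIV (\<lambda>t. matrix_inv (\<Phi> t) *\<^sub>V f t)"
    by (intro act.continuous_on f)
  then obtain \<psi> where \<psi>: "\<And>t. (\<psi> has_vector_derivative matrix_inv (\<Phi> t) *\<^sub>V f t) (at t)"
    by (rule continuous_antiderivative_exists) (rule that)
  obtain C where C: "C \<ge> 0"
    "\<And>s (v :: 'v ^ 'p). s < 0 \<Longrightarrow>
      norm (P *\<^sub>V matrix_inv (\<Phi> s) *\<^sub>V v) \<le> C * exp (\<alpha> * s) * norm v"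
    "\<And>s (v :: 'v ^ 'p). s > 0 \<Longrightarrow>
      norm ((mat 1 - P) *\<^sub>V matrix_inv (\<Phi> s) *\<^sub>V v) \<le> C * exp (- \<alpha> * s) * norm v"
    by (rule dichotomy_decay [OF \<Phi> G]) (rule that)
  have le: "C * exp r * norm (f s) \<le> C * B * exp r" for r s
    using mult_left_mono [OF f(2) [of s], of "C * exp r"] C(1) by (simp add: mult_ac)
  obtain p where p: "((\<lambda>s. P *\<^sub>V \<psi> s) \<longlongrightarrow> p) at_bot"
    by (rule convergent_at_bot_if_exp_derivative [OF \<alpha> deriv [OF \<psi>], of P "C * B"])
      (rule order_trans [OF C(2) le], assumption, rule that)
  obtain q where q: "((\<lambda>s. (mat 1 - P) *\<^sub>V \<psi> s) \<longlongrightarrow> q) at_top"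
    by (rule convergent_at_top_if_exp_derivative [OF \<alpha> deriv [OF \<psi>], of "mat 1 - P" "C * B"])
      (rule order_trans [OF C(3) le], assumption, rule that)
  \<comment> \<open>Subtracting the constants \<open>p\<close> and \<open>q\<close> changes \<Phi>
    \<psi> by a solution of the homogeneous equation, so the differential equation is kept while
    \<open>y\<close> becomes the Green integral.\<close>
  define y where "y t = \<Phi> t *\<^sub>V (\<psi> t - p - q)" for t
  have "(y has_vector_derivative A t *\<^sub>V y t + f t) (at t)" for t
  proof -
    have "(\<Phi> has_vector_derivative A t ** \<Phi> t) (at t)"
      using \<Phi> by (simp add: fundamental_matrix_def)
    moreover have "((\<lambda>t. \<psi> t - p - q) has_vector_derivative matrix_inv (\<Phi> t) *\<^sub>V f t) (at t)"
      by (simp only: has_vector_derivative_diff_const \<psi>)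
    ultimately have "((\<lambda>t. \<Phi> t *\<^sub>V (\<psi> t - p - q)) has_vector_derivative
        \<Phi> t *\<^sub>V matrix_inv (\<Phi> t) *\<^sub>V f t + (A t ** \<Phi> t) *\<^sub>V (\<psi> t - p - q)) (at t)"
      by (rule act.has_vector_derivative)
    then show ?thesis
      unfolding y_def by (simp add: fundamental_matrix_cancel [OF \<Phi>] matrix_act_assoc add.commute)
  qed
  then have "linear_ode_solution A f y"
    by (simp add: linear_ode_solution_def)
  moreover have "((\<lambda>s. green_matrix \<Phi> P t s *\<^sub>V f s) has_integral y t) UNIV" for t
    unfolding y_def by (rule has_integral_green [OF \<psi> p q])
  ultimately show thesis by (rule that)
qed

section \<open>Existence, uniqueness and the sup bound for almost automorphic solutions\<close>

theorem theorem3p5: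
  fixes A \<Phi> :: "real \<Rightarrow> complex ^ 'p ^ 'p"
    and P :: "complex ^ 'p ^ 'p"
    and f :: "real \<Rightarrow> ('v::complex_banach) ^ 'p"
    and normM :: "complex ^ 'p ^ 'p \<Rightarrow> real"
    and normV :: "'v ^ 'p \<Rightarrow> real"
    and c \<alpha> :: real
  assumes "is_norm normM"
    and "equivalent_norm normV"
    and "compatible_norms normM normV"
    and "A \<in> almost_automorphic"
    and "exponential_dichotomy normM A \<Phi> P c \<alpha>"
    and "\<forall>t. P ** \<Phi> t = \<Phi> t ** P"
    and "f \<in> almost_automorphic"
  shows "\<exists>y \<in> almost_automorphic.
    linear_ode_solution A f y \<and>
    (\<forall>z \<in> almost_automorphic. linear_ode_solution A f z \<longrightarrow> z = y) \<and>
    (\<forall>t. ((\<lambda>s. green_matrix \<Phi> P t s *\<^sub>V f s) has_integral y t) UNIV) \<and>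
    sup_norm normV y \<le> (2 * c / \<alpha>) * sup_norm normV f"
proof -
  interpret act: bounded_bilinear "(*\<^sub>V) :: complex ^ 'p ^ 'p \<Rightarrow> 'v ^ 'p \<Rightarrow> 'v ^ 'p"
    by (rule bounded_bilinear_matrix_act)
  have \<Phi>: "fundamental_matrix A \<Phi>" and c: "c > 0" and \<alpha>: "\<alpha> > 0"
    and dich: "\<And>t s. normM (green_matrix \<Phi> P t s) \<le> c * exp (- \<alpha> * \<bar>t - s\<bar>)"
    using assms(5) unfolding exponential_dichotomy_def by auto
  obtain a b where a: "a > 0" and b: "b > 0"
    and ab: "\<And>x. a * norm x \<le> normV x" "\<And>x. normV x \<le> b * norm x"
    using assms(2) unfolding equivalent_norm_def by blast
  have normV_nonneg: "normV x \<ge> 0" for x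
    using order_trans [OF mult_nonneg_nonneg [OF less_imp_le [OF a] norm_ge_zero] ab(1)] .
  have normV_green: "normV (green_matrix \<Phi> P t s *\<^sub>V v) \<le> c * exp (- \<alpha> * \<bar>t - s\<bar>) * normV v" for t s v
    using assms(3) order_trans mult_right_mono [OF dich normV_nonneg]
    unfolding compatible_norms_def by blast
  \<comment> \<open>Passing from the library norm to \<open>normV\<close> on the vector costs
    \<open>b\<close>, and returning on the image costs 1 / \<open>a\<close>; \<open>K\<close> is the
    dichotomy constant for the library norm.\<close>
  define K where "K = c * b / a"
  have K: "K \<ge> 0" using a b c by (simp add: K_def)
  have green: "norm (green_matrix \<Phi> P t s *\<^sub>V v) \<le> K * exp (- \<alpha> * \<bar>t - s\<bar>) * norm v"
    for t s and v :: "'v ^ 'p"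
  proof -
    have "a * norm (green_matrix \<Phi> P t s *\<^sub>V v) \<le> c * exp (- \<alpha> * \<bar>t - s\<bar>) * normV v"
      by (rule order_trans [OF ab(1) normV_green])
    also have "\<dots> \<le> c * exp (- \<alpha> * \<bar>t - s\<bar>) * (b * norm v)"
      using c by (intro mult_left_mono ab) auto
    finally show ?thesis
      using a by (simp add: K_def field_simps)
  qed
  obtain Bf where Bf: "\<And>t. norm (f t) \<le> Bf"
    using almost_automorphic_bounded [OF assms(7)] by blast
  obtain y where y: "linear_ode_solution A f y"
    and y_int: "\<And>t. ((\<lambda>s. green_matrix \<Phi> P t s *\<^sub>V f s) has_integral y t) UNIV"
    by (rule exists_solution_green [OF \<Phi> \<alpha> green almost_automorphic_continuous [OF assms(7)] Bf])
      (rule that)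
  \<comment> \<open>The norm is left general for two uses: the library norm gives the boundedness of
    \<open>y\<close> needed for its translates, and \<open>normV\<close> gives the constant 2 c /
    \<alpha> without the loss factor b / a.\<close>
  have y_le: "N (y t) \<le> L * B * (2 / \<alpha>)"
    if N: "equivalent_norm N" and L: "L \<ge> 0"
      and G: "\<And>t s v. N (green_matrix \<Phi> P t s *\<^sub>V v) \<le> L * exp (- \<alpha> * \<bar>t - s\<bar>) * N v"
      and B: "\<And>s. N (f s) \<le> B" for N t L B
  proof (rule equivalent_norm_integral_le [OF N y_int])
    show "((\<lambda>s. L * B * exp (- \<alpha> * \<bar>t - s\<bar>)) has_integral L * B * (2 / \<alpha>)) UNIV"
      by (intro has_integral_mult_right has_integral_exp_abs \<alpha>)
    show "N (green_matrix \<Phi> P t s *\<^sub>V f s) \<le> L * B * exp (- \<alpha> * \<bar>t - s\<bar>)" for s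
      using order_trans [OF G [of t s "f s"] mult_left_mono [OF B]] L by (simp add: mult_ac)
  qed
  have "equivalent_norm (norm :: 'v ^ 'p \<Rightarrow> real)"
    unfolding equivalent_norm_def is_norm_def
    by (intro conjI exI [of _ 1]) (auto simp: norm_triangle_ineq)
  then have y_bounded: "norm (y t) \<le> K * Bf * (2 / \<alpha>)" for t
    using y_le [OF _ K green Bf] by blast
  have "sup_norm normV y \<le> (2 * c / \<alpha>) * sup_norm normV f"
  proof -
    \<comment> \<open>A real supremum dominates the values only for a bounded function; for
      \<open>f\<close> this comes from almost automorphy.\<close>
    have "bdd_above (range (\<lambda>t. normV (f t)))"
      by (rule bdd_aboveI2 [OF order_trans [OF ab(2) mult_left_mono [OF Bf less_imp_le [OF b]]]])
    then have "normV (f t) \<le> sup_norm normV f" for t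
      unfolding sup_norm_def by (rule cSUP_upper [OF UNIV_I])
    then have "normV (y t) \<le> c * sup_norm normV f * (2 / \<alpha>)" for t
      using y_le [OF assms(2) less_imp_le [OF c] normV_green] by blast
    then show ?thesis
      unfolding sup_norm_def [of normV y] by (intro cSUP_least) (auto simp: mult_ac)
  qed
  \<comment> \<open>An almost automorphic solution is bounded, hence equals the same Green integral
    as \<open>y\<close>.\<close>
  moreover have "z = y" if z_aa: "z \<in> almost_automorphic" and z: "linear_ode_solution A f z" for z
  proof
    fix t
    obtain Bz where Bz: "\<And>t. norm (z t) \<le> Bz"
      using almost_automorphic_bounded [OF z_aa] by blast
    show "z t = y t"
      by (rule has_integral_unique [OF bounded_solution_has_integral_green [OF \<Phi> \<alpha> green z Bz] y_int])
  qed
  moreover have "y \<in> almost_automorphic"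
  proof -
    define H where "H t = (A t, f t)" for t
    have H: "H \<in> almost_automorphic"
      unfolding H_def by (rule almost_automorphic_Pair [OF assms(4,7)])
    obtain BH where BH: "\<And>t. norm (H t) \<le> BH"
      using almost_automorphic_bounded [OF H] by blast
    define By where "By = K * Bf * (2 / \<alpha>)"
    have By: "norm (y t) \<le> By" for t
      unfolding By_def by (rule y_bounded)
    have By0: "By \<ge> 0" using By [of 0] norm_ge_zero order_trans by blast
    obtain k where k: "k > 0" "\<And>M (v :: 'v ^ 'p). norm (M *\<^sub>V v) \<le> norm M * norm v * k"
      using act.pos_bounded by blast
    \<comment> \<open>\<open>By * k\<close> accounts for the increment of \<open>A\<close> acting on
      a value of \<open>y\<close>, and the summand 1 for the increment of \<open>f\<close>.\<close>
    define L where "L = By * k + 1"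
    have L: "L \<ge> 0" using By0 k by (simp add: L_def)
    have y_cont: "continuous_on UNIV y"
      using y has_vector_derivative_continuous unfolding linear_ode_solution_def
      by (metis continuous_at_imp_continuous_on)
    have "norm (y (t + h) - y t) \<le>
        K * L * integral UNIV (\<lambda>u. exp (- \<alpha> * \<bar>u\<bar>) * norm (H (t + h - u) - H (t - u)))" for t h
    proof -
      define w where "w s = y (s + h) - y s" for s
      \<comment> \<open>In the difference of the equations at \<open>s + h\<close> and
        \<open>s\<close>, the increment of \<open>A\<close> is paired with the translated value
        \<open>y (s + h)\<close>, so that exactly \<open>A s\<close> acting on \<open>w s\<close> is
        left over.\<close>
      define g where "g s = (A (s + h) - A s) *\<^sub>V y (s + h) + (f (s + h) - f s)" for s
      have "(w has_vector_derivative A s *\<^sub>V w s + g s) (at s)" for s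
      proof -
        have "((\<lambda>s. y (s + h)) has_vector_derivative A (s + h) *\<^sub>V y (s + h) + f (s + h)) (at s)"
        proof -
          have "((\<lambda>s. s + h) has_vector_derivative 1) (at s)"
            by (auto intro!: derivative_eq_intros)
          moreover have "(y has_vector_derivative A (s + h) *\<^sub>V y (s + h) + f (s + h)) (at (s + h))"
            using y unfolding linear_ode_solution_def by blast
          ultimately show ?thesis
            using vector_diff_chain_at [of "\<lambda>s. s + h" 1 s y] by (simp add: o_def)
        qed
        moreover have "(y has_vector_derivative A s *\<^sub>V y s + f s) (at s)"
          using y unfolding linear_ode_solution_def by blast
        ultimately have "(w has_vector_derivative
            (A (s + h) *\<^sub>V y (s + h) + f (s + h)) - (A s *\<^sub>V y s + f s)) (at s)"
          unfolding w_def by (rule has_vector_derivative_diff)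
        then show ?thesis
          by (simp add: w_def g_def act.diff_left act.diff_right algebra_simps)
      qed
      then have w_sol: "linear_ode_solution A g w"
        by (simp add: linear_ode_solution_def)
      have w_bounded: "norm (w s) \<le> By + By" for s
        unfolding w_def by (rule order_trans [OF norm_triangle_ineq4 add_mono [OF By By]])
      have g_le: "norm (g s) \<le> L * norm (H (s + h) - H s)" for s
      proof -
        have "norm (A (s + h) - A s) \<le> norm (H (s + h) - H s)"
          "norm (f (s + h) - f s) \<le> norm (H (s + h) - H s)"
          using norm_fst_le [of "A (s + h) - A s" "f (s + h) - f s"]
            norm_snd_le [of "f (s + h) - f s" "A (s + h) - A s"] by (simp_all add: H_def)
        moreover have "norm ((A (s + h) - A s) *\<^sub>V y (s + h)) \<le> norm (A (s + h) - A s) * By * k"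
          using k(1) by (intro order_trans [OF k(2)] mult_right_mono mult_left_mono By) auto
        moreover have "norm (A (s + h) - A s) * (By * k) \<le> norm (H (s + h) - H s) * (By * k)"
          using calculation(1) By0 k(1) by (intro mult_right_mono) auto
        ultimately show ?thesis
          using norm_triangle_ineq [of "(A (s + h) - A s) *\<^sub>V y (s + h)" "f (s + h) - f s"]
          by (simp add: g_def L_def algebra_simps)
      qed
      define I where "I = integral UNIV (\<lambda>u. exp (- \<alpha> * \<bar>u\<bar>) * norm (H (t + h - u) - H (t - u)))"
      have "(\<lambda>u. exp (- \<alpha> * \<bar>u\<bar>) * norm (H (t + h - u) - H (t - u))) integrable_on UNIV"
      proof (rule exp_abs_mult_integrable [OF \<alpha>])
        show "continuous_on UNIV (\<lambda>u. norm (H (t + h - u) - H (t - u)))"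
          by (intro continuous_intros continuous_on_compose2 [OF almost_automorphic_continuous [OF H]]) auto
        show "\<bar>norm (H (t + h - u) - H (t - u))\<bar> \<le> BH + BH" for u
          using order_trans [OF norm_triangle_ineq4 add_mono [OF BH BH]] by simp
      qed
      \<comment> \<open>The substitution u = t - s turns \<open>t + h - u\<close> into
        \<open>s + h\<close> and centres the kernel at \<open>t\<close>.\<close>
      then have "((\<lambda>s. exp (- \<alpha> * \<bar>t - s\<bar>) * norm (H (s + h) - H s)) has_integral I) UNIV"
        using has_integral_UNIV_reflect [OF integrable_integral, of _ t]
        unfolding I_def by (fastforce simp: algebra_simps)
      then have "((\<lambda>s. K * L * (exp (- \<alpha> * \<bar>t - s\<bar>) * norm (H (s + h) - H s))) has_integral K * L * I) UNIV"
        by (rule has_integral_mult_right)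
      moreover have "norm (green_matrix \<Phi> P t s *\<^sub>V g s) \<le>
          K * L * (exp (- \<alpha> * \<bar>t - s\<bar>) * norm (H (s + h) - H s))" for s
        using order_trans [OF green [of t s "g s"] mult_left_mono [OF g_le]] K by (simp add: mult_ac)
      \<comment> \<open>Being bounded, \<open>w\<close> is the Green integral of its own forcing
        term \<open>g\<close>, so the pointwise bound on the integrand can be integrated.\<close>
      ultimately have "norm (w t) \<le> K * L * I"
        using equivalent_norm_integral_le [OF \<open>equivalent_norm norm\<close>
            bounded_solution_has_integral_green [OF \<Phi> \<alpha> green w_sol w_bounded]] by blast
      then show ?thesis
        by (simp add: w_def I_def)
    qed
    then show ?thesis
      by (rule almost_automorphic_if_modulus_le [OF H y_cont \<alpha> mult_nonneg_nonneg [OF K L]])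
  qed
  ultimately show ?thesis
    using y y_int by blast
qed

end
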